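(* Let $f:\mathbb{R}^n\to\mathbb{R}$ be convex and differentiable with Lipschitz continuous gradient, let $\bm{x}^{k-1},\bm{x}^k\in\mathbb{R}^n$, and put $\bm{s}^{k-1}=\bm{x}^k-\bm{x}^{k-1}$ and $\bm{y}^{k-1}=\nabla f(\bm{x}^k)-\nabla f(\bm{x}^{k-1})$. Suppose $(\bm{s}^{k-1})^\top\bm{y}^{k-1}>0$, let $$\alpha_k>\frac{\|\bm{s}^{k-1}\|^2}{(\bm{s}^{k-1})^\top\bm{y}^{k-1}},$$ and choose $$\bm{m}^k=\alpha_k\bm{y}^{k-1}-\bm{s}^{k-1},\qquad \mu_k=\frac{\|\bm{m}^k\|^2}{\alpha_k(\bm{m}^k)^\top\bm{y}^{k-1}}.$$ Then $\mu_k\in[0,1)$, the matrix $$\mathrm{M}_k=\mathrm{I}_n+\frac{\mu_k}{1-\mu_k}\frac{\bm{m}^k(\bm{m}^k)^\top}{\|\bm{m}^k\|^2}$$ satisfies the secant equation $$\mathrm{M}_k(\bm{x}^k-\bm{x}^{k-1})=\alpha_k[\nabla f(\bm{x}^k)-\nabla f(\bm{x}^{k-1})],$$ and the Adaptive Inertial Method update with these $\bm{m}^k$ and $\mu_k$ takes the form $$\bm{x}^{k+1}=\bm{x}^k-\beta_k\left(\mathrm{I}_n-\frac{\bm{m}^k(\bm{m}^k)^\top}{\alpha_k(\bm{m}^k)^\top\bm{y}^{k-1}}\right)\nabla f(\bm{x}^k).$$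
   Context: The Adaptive Inertial Method update with step size $\beta_k>0$, parameter $\mu_k\in[0,1)$ and nonzero inertial term $\bm{m}^k\in\mathbb{R}^n$ is $$\bm{x}^{k+1}=\bm{x}^k-\beta_k\nabla f(\bm{x}^k)+\gamma_k\bm{m}^k,\qquad \gamma_k=\mu_k\frac{(\bm{m}^k)^\top\nabla f(\bm{x}^k)}{\|\bm{m}^k\|^2}\beta_k.$$ $\|\cdot\|$ is the Euclidean norm and $\mathrm{I}_n$ the identity matrix. *)

theory Defs
  imports "HOL-Analysis.Analysis"
begin

definition outer_prod :: "real ^ 'n \<Rightarrow> real ^ 'n \<Rightarrow> real ^ 'n ^ 'n" where
  "outer_prod u v = (columnvector u :: real ^ 1 ^ 'n) ** (rowvector v :: real ^ 'n ^ 1)"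

definition aim_gamma ::
  "(real ^ 'n \<Rightarrow> real ^ 'n) \<Rightarrow> real \<Rightarrow> real \<Rightarrow> real ^ 'n \<Rightarrow> real ^ 'n \<Rightarrow> real" where
  "aim_gamma grad \<beta> \<mu> m x = \<mu> * ((m \<bullet> grad x) / (norm m)\<^sup>2) * \<beta>"

(* The Adaptive Inertial Method update. It is meant for step size \<beta> > 0,
   \<mu> \<in> {0..<1} and m \<noteq> 0; the value for m = 0 is an artefact of x / 0 = 0. *)
definition aim_step ::
  "(real ^ 'n \<Rightarrow> real ^ 'n) \<Rightarrow> real \<Rightarrow> real \<Rightarrow> real ^ 'n \<Rightarrow> real ^ 'n \<Rightarrow> real ^ 'n" where
  "aim_step grad \<beta> \<mu> m x = x - \<beta> *\<^sub>R grad x + aim_gamma grad \<beta> \<mu> m x *\<^sub>R m"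

end

(* Since alpha y = m + s, the denominator of mu is alpha (m . y) = |m|^2 + m . s, while
   the bound on alpha says exactly m . s > 0. Hence mu lies in [0,1) and the rank-one
   coefficient of M equals 1 / (m . s), so M s = s + m = alpha y. *)
theory Submission
  imports Defs
begin

text \<open>Associativity, (u v^T) w = u (v^T w). Matrix entries are unfolded only here; afterwards
  a rank-one matrix acts through an inner product.\<close>

lemma outer_prod_mult_vec: "outer_prod u v *v w = (v \<bullet> w) *\<^sub>R u"
  by (simp add: outer_prod_def vec_eq_iff matrix_matrix_mult_def matrix_vector_mult_def
      columnvector_def rowvector_def inner_vec_def sum_distrib_left sum_distrib_right mult.commute
      mult.left_commute)

theorem mainTheorem4:
  fixes f :: "real ^ 'n \<Rightarrow> real"
    and grad :: "real ^ 'n \<Rightarrow> real ^ 'n"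
    and x_prev x s y m :: "real ^ 'n"
    and \<alpha> \<beta> \<mu> :: real
    and M :: "real ^ 'n ^ 'n"
  assumes "convex_on UNIV f"
    and "\<And>z. GDERIV f z :> grad z"
    and "\<exists>L. L-lipschitz_on UNIV grad"
    and "s = x - x_prev"
    and "y = grad x - grad x_prev"
    and "s \<bullet> y > 0"
    and "\<alpha> > (norm s)\<^sup>2 / (s \<bullet> y)"
    and "m = \<alpha> *\<^sub>R y - s"
    and "\<mu> = (norm m)\<^sup>2 / (\<alpha> * (m \<bullet> y))"
    and "M = mat 1 + (\<mu> / (1 - \<mu>)) *\<^sub>R ((1 / (norm m)\<^sup>2) *\<^sub>R outer_prod m m)"
    and "\<beta> > 0"
  shows "m \<noteq> 0 \<and> \<alpha> * (m \<bullet> y) \<noteq> 0 \<and>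
    \<mu> \<in> {0..<1} \<and>
    M *v (x - x_prev) = \<alpha> *\<^sub>R (grad x - grad x_prev) \<and>
    aim_step grad \<beta> \<mu> m x =
      x - \<beta> *\<^sub>R ((mat 1 - (1 / (\<alpha> * (m \<bullet> y))) *\<^sub>R outer_prod m m) *v grad x)"
proof -
  \<comment> \<open>Expanding \<open>m\<close> gives \<alpha> (s . y) - |s|^2, which is positive
    once the bound on \<alpha> is multiplied by s . y > 0.\<close>
  have ms: "m \<bullet> s > 0"
    using assms(6,7)
    by (simp add: assms(8) inner_diff_left inner_diff_right power2_norm_eq_inner field_simps inner_commute)
  then have m0: "m \<noteq> 0"
    by auto
  then have nm: "(norm m)\<^sup>2 > 0"
    by simp
  have my: "\<alpha> *\<^sub>R y = m + s"
    by (simp add: assms(8))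
  have "\<alpha> * (m \<bullet> y) = m \<bullet> (\<alpha> *\<^sub>R y)"
    by simp
  then have D: "\<alpha> * (m \<bullet> y) = (norm m)\<^sup>2 + m \<bullet> s"
    by (simp only: my inner_add_right power2_norm_eq_inner)
  have mu: "\<mu> = (norm m)\<^sup>2 / ((norm m)\<^sup>2 + m \<bullet> s)"
    using assms(9) D by simp
  \<comment> \<open>The strict upper bound comes from \<open>ms\<close>: the denominator exceeds the
    numerator by m . s.\<close>
  have mu_range: "\<mu> \<in> {0..<1}"
    using ms add_pos_pos[OF nm ms] by (simp add: mu divide_less_eq)
  have "1 - \<mu> = (m \<bullet> s) / ((norm m)\<^sup>2 + m \<bullet> s)"
    using add_pos_pos[OF nm ms] by (simp add: mu diff_divide_eq_iff)
  \<comment> \<open>\<mu> and 1 - \<mu> share the denominator |m|^2 + m . s, so their quotient is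
    |m|^2 / (m . s).\<close>
  then have coeff: "\<mu> / (1 - \<mu>) * (1 / (norm m)\<^sup>2) = 1 / (m \<bullet> s)"
    using nm add_pos_pos[OF nm ms] by (simp add: mu)
  have "M *v s = s + (\<mu> / (1 - \<mu>) * (1 / (norm m)\<^sup>2)) *\<^sub>R ((m \<bullet> s) *\<^sub>R m)"
    by (simp add: assms(10) matrix_vector_mult_add_rdistrib scaleR_matrix_vector_assoc [symmetric]
        outer_prod_mult_vec)
  also have "\<dots> = \<alpha> *\<^sub>R y"
    unfolding coeff using ms by (simp add: my add.commute)
  finally have secant: "M *v s = \<alpha> *\<^sub>R y" .
  \<comment> \<open>With |m|^2 cancelled, the inertial term is \<beta> times the rank-one matrix of
    the claim applied to the gradient.\<close>
  have "\<mu> / (norm m)\<^sup>2 = 1 / (\<alpha> * (m \<bullet> y))"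
    using nm by (simp add: assms(9))
  then have "aim_gamma grad \<beta> \<mu> m x = \<beta> * (1 / (\<alpha> * (m \<bullet> y)) * (m \<bullet> grad x))"
    by (metis aim_gamma_def mult.commute times_divide_eq_left times_divide_eq_right)
  then have step: "aim_step grad \<beta> \<mu> m x =
      x - \<beta> *\<^sub>R ((mat 1 - (1 / (\<alpha> * (m \<bullet> y))) *\<^sub>R outer_prod m m) *v grad x)"
    by (simp add: aim_step_def matrix_vector_mult_diff_rdistrib
        scaleR_matrix_vector_assoc [symmetric] outer_prod_mult_vec scaleR_diff_right)
  \<comment> \<open>By \<open>D\<close>, \<alpha> (m . y) is a sum of two positive terms, hence
    nonzero. With m nonzero, the quotients by it and by |m|^2 are genuine, not cases of x / 0 =
    0.\<close>
  show ?thesis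
    using m0 D add_pos_pos[OF nm ms] mu_range secant step
    unfolding assms(4,5) by (metis less_irrefl)
qed

end
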